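(* There exists no random bit optimal scattering algorithm using only global weak multiplicity detection whose expected number of rounds to scatter $n$ robots is $o(\log\log n)$.
   Context: Mobile robot model: robots are points in the plane; anonymous, oblivious, disoriented; fully synchronous rounds in which every robot Looks (snapshot of positions), Computes a destination (possibly randomly) and Moves toward it. A configuration is the multiset of robot positions; it is scattered when no two robots share a position. With global weak multiplicity detection, a robot's snapshot shows the set of occupied points and, for each, whether it holds one robot or more than one, but not the number of robots; robots do not know the total number $n$. Random bits: choosing uniformly among $k$ possibilities uses $\log_2 k$ bits; bits used by robots alone at their position are not counted. A scattering algorithm is random bit optimal if the expected number of random bits it uses to scatter $n$ robots is $O(n\log n)$ (every scattering algorithm needs at least $n\log_2 n$).
   Formalization: In each round a robot makes a single uniform choice among k possibilities, k fixed by its snapshot; with adaptive sequences of random choices, charged by expected bits, the claim fails, since O(1) expected rounds with O(n log n) expected bits are possible. *)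

theory Defs
  imports "HOL-Probability.Probability" "HOL-Library.Landau_Symbols"
begin

type_synonym point = "real^2"

text \<open>
  The \<open>n\<close> robots are the indices \<open>i < n\<close>; they serve the analysis only and are never visible to
  the algorithm. The configuration is the multiset of the values \<open>c i\<close>, \<open>i < n\<close>; values of \<open>c\<close>
  outside \<open>{..<n}\<close> are irrelevant.
\<close>

type_synonym config = "nat \<Rightarrow> point"

definition scattered :: "nat \<Rightarrow> config \<Rightarrow> bool" where
  "scattered n c \<longleftrightarrow> inj_on c {..<n}"

definition shared :: "nat \<Rightarrow> config \<Rightarrow> nat \<Rightarrow> bool" where
  "shared n c i \<longleftrightarrow> (\<exists>j<n. j \<noteq> i \<and> c j = c i)"

text \<open>
  Robots are disoriented: a local frame maps global displacements from the robot's own position to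
  local coordinates, by a linear similarity with arbitrary unit length, orientation and chirality.
\<close>

type_synonym frame = "point \<Rightarrow> point"

definition is_frame :: "frame \<Rightarrow> bool" where
  "is_frame f \<longleftrightarrow> linear f \<and> (\<exists>s>0. \<forall>x. norm (f x) = s * norm x)"

text \<open>
  Global weak multiplicity detection: the set of occupied points, and the set of those that hold
  more than one robot, in local coordinates with the observing robot at the origin.
\<close>

type_synonym snapshot = "point set \<times> point set"

definition snapshot :: "nat \<Rightarrow> config \<Rightarrow> frame \<Rightarrow> nat \<Rightarrow> snapshot" where
  "snapshot n c f i =
     ((\<lambda>j. f (c j - c i)) ` {..<n},
      (\<lambda>j. f (c j - c i)) ` {j. j < n \<and> shared n c j})"

text \<open>
  An oblivious algorithm maps a snapshot to the possibilities for the destination, in local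
  coordinates. One of them is chosen uniformly, which uses \<open>log 2 k\<close> random bits for \<open>k\<close>
  possibilities. A multiset allows several possibilities to lead to the same destination.
\<close>

type_synonym algorithm = "snapshot \<Rightarrow> point multiset"

definition well_defined :: "algorithm \<Rightarrow> bool" where
  "well_defined A \<longleftrightarrow> (\<forall>S. A S \<noteq> {#})"

definition destination :: "algorithm \<Rightarrow> nat \<Rightarrow> config \<Rightarrow> frame \<Rightarrow> nat \<Rightarrow> point pmf" where
  "destination A n c f i =
     map_pmf (\<lambda>x. c i + inv f x) (pmf_of_multiset (A (snapshot n c f i)))"

definition round_bits :: "algorithm \<Rightarrow> nat \<Rightarrow> config \<Rightarrow> (nat \<Rightarrow> frame) \<Rightarrow> real" where
  "round_bits A n c F =
     (\<Sum>i | i < n \<and> shared n c i. log 2 (real (size (A (snapshot n c (F i) i)))))"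

text \<open>
  A robot moves on the segment towards its destination, and either reaches it or covers a distance
  of at least \<open>\<delta>\<close>. Rigid moves, which always reach the destination, are the case \<open>\<delta> = \<infinity>\<close>.
\<close>

definition moves_toward :: "ereal \<Rightarrow> point \<Rightarrow> point \<Rightarrow> point \<Rightarrow> bool" where
  "moves_toward \<delta> p d q \<longleftrightarrow>
     q \<in> closed_segment p d \<and> min \<delta> (ereal (dist p d)) \<le> ereal (dist p q)"

text \<open>
  What the model leaves open is decided by an adversary that knows the history, the list of the
  configurations so far with the current one last. It fixes the local frames before the random
  choices of the round, and the stopping points after them: \<open>stop adv h d i\<close> is the new position of
  robot \<open>i\<close> when \<open>d\<close> gives the destinations.
\<close>

record adversary =
  frames :: "config list \<Rightarrow> nat \<Rightarrow> frame"
  stop :: "config list \<Rightarrow> config \<Rightarrow> config"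

definition is_adversary :: "ereal \<Rightarrow> nat \<Rightarrow> adversary \<Rightarrow> bool" where
  "is_adversary \<delta> n adv \<longleftrightarrow>
     (\<forall>h. h \<noteq> [] \<longrightarrow>
        (\<forall>i<n. is_frame (frames adv h i)) \<and>
        (\<forall>d. \<forall>i<n. moves_toward \<delta> (last h i) (d i) (stop adv h d i)))"

definition round_pmf :: "algorithm \<Rightarrow> nat \<Rightarrow> adversary \<Rightarrow> config list \<Rightarrow> config pmf" where
  "round_pmf A n adv h =
     map_pmf (stop adv h)
       (Pi_pmf {..<n} 0 (\<lambda>i. destination A n (last h) (frames adv h i) i))"

text \<open>Distribution of the history after \<open>t\<close> fully synchronous rounds; it has \<open>t + 1\<close> entries.\<close>

primrec exec :: "algorithm \<Rightarrow> nat \<Rightarrow> adversary \<Rightarrow> config \<Rightarrow> nat \<Rightarrow> config list pmf" where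
  "exec A n adv c 0 = return_pmf [c]"
| "exec A n adv c (Suc t) =
     bind_pmf (exec A n adv c t) (\<lambda>h. map_pmf (\<lambda>c'. h @ [c']) (round_pmf A n adv h))"

definition rounds_used :: "nat \<Rightarrow> config list \<Rightarrow> nat" where
  "rounds_used n h = length (takeWhile (\<lambda>c. \<not> scattered n c) h)"

definition bits_used :: "algorithm \<Rightarrow> nat \<Rightarrow> adversary \<Rightarrow> config list \<Rightarrow> real" where
  "bits_used A n adv h =
     (\<Sum>j<rounds_used n h. round_bits A n (h ! j) (frames adv (take (Suc j) h)))"

text \<open>
  Along a growing history \<open>rounds_used\<close> and \<open>bits_used\<close> increase to the number of rounds and of
  random bits until the first scattered configuration. By monotone convergence the suprema over
  \<open>t\<close> below are the expectations of these two numbers (possibly infinite).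
\<close>

definition expected_rounds_from :: "algorithm \<Rightarrow> nat \<Rightarrow> adversary \<Rightarrow> config \<Rightarrow> ennreal" where
  "expected_rounds_from A n adv c =
     (SUP t. \<integral>\<^sup>+ h. of_nat (rounds_used n h) \<partial>measure_pmf (exec A n adv c t))"

definition expected_bits_from :: "algorithm \<Rightarrow> nat \<Rightarrow> adversary \<Rightarrow> config \<Rightarrow> ennreal" where
  "expected_bits_from A n adv c =
     (SUP t. \<integral>\<^sup>+ h. ennreal (bits_used A n adv h) \<partial>measure_pmf (exec A n adv c t))"

text \<open>Worst case over the initial configuration of \<open>n\<close> robots and over the adversary.\<close>

definition expected_rounds :: "ereal \<Rightarrow> algorithm \<Rightarrow> nat \<Rightarrow> ennreal" where
  "expected_rounds \<delta> A n =
     (SUP adv\<in>{adv. is_adversary \<delta> n adv}. SUP c. expected_rounds_from A n adv c)"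

definition expected_bits :: "ereal \<Rightarrow> algorithm \<Rightarrow> nat \<Rightarrow> ennreal" where
  "expected_bits \<delta> A n =
     (SUP adv\<in>{adv. is_adversary \<delta> n adv}. SUP c. expected_bits_from A n adv c)"

text \<open>A scattered configuration is reached with probability 1.\<close>

definition scattering_algorithm :: "ereal \<Rightarrow> algorithm \<Rightarrow> bool" where
  "scattering_algorithm \<delta> A \<longleftrightarrow> well_defined A \<and>
     (\<forall>n adv c. is_adversary \<delta> n adv \<longrightarrow>
        (\<lambda>t. measure_pmf.prob (exec A n adv c t) {h. \<exists>c'\<in>set h. scattered n c'})
          \<longlonglongrightarrow> 1)"

text \<open>Finiteness is required separately because \<open>enn2real\<close> maps \<open>\<infinity>\<close> to \<open>0\<close>.\<close>

definition random_bit_optimal :: "ereal \<Rightarrow> algorithm \<Rightarrow> bool" where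
  "random_bit_optimal \<delta> A \<longleftrightarrow>
     (\<forall>\<^sub>F n in sequentially. expected_bits \<delta> A n < \<infinity>) \<and>
     (\<lambda>n. enn2real (expected_bits \<delta> A n)) \<in> O(\<lambda>n. real n * ln (real n))"

definition rounds_o_loglog :: "ereal \<Rightarrow> algorithm \<Rightarrow> bool" where
  "rounds_o_loglog \<delta> A \<longleftrightarrow>
     (\<forall>\<^sub>F n in sequentially. expected_rounds \<delta> A n < \<infinity>) \<and>
     (\<lambda>n. enn2real (expected_rounds \<delta> A n)) \<in> o(\<lambda>n. ln (ln (real n)))"

end

theory Submission imports Defs begin

text \<open>
  A snapshot does not reveal how many robots sit on a point of multiplicity. Hence a robot that
  sees \<open>m\<close> occupied points may be one of about \<open>n / 2\<close> robots on its point in a configuration of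
  \<open>n = O(m)\<close> robots, so that \<open>O(n log n)\<close> random bits allow it only polynomially (in \<open>m\<close>) many
  possibilities. If all frames agree and all moves are rigid, then the number of occupied points
  grows at most from \<open>m\<close> to a fixed power of \<open>m\<close> (up to constants) in one round, whatever the random
  choices. Starting from a single point, it takes a number of rounds of order \<open>log log n\<close> to reach
  \<open>n\<close> points.
\<close>

section \<open>Occupied points, snapshots in a common frame, and the adversary\<close>

definition occupied :: "nat \<Rightarrow> config \<Rightarrow> point set" where
  "occupied n c = c ` {..<n}"

definition shared_points :: "nat \<Rightarrow> config \<Rightarrow> point set" where
  "shared_points n c = c ` {j. j < n \<and> shared n c j}"

lemma finite_occupied [simp]: "finite (occupied n c)"
  by (simp add: occupied_def)

lemma shared_points_subset: "shared_points n c \<subseteq> occupied n c"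
  by (auto simp: shared_points_def occupied_def)

text \<open>With identity frames a snapshot depends on the robot only through its position, and on
  the configuration only through two point sets. Robots on one point thus see the same, and
  configurations with different numbers of robots can look alike.\<close>

lemma snapshot_id:
  "snapshot n c id i =
     ((\<lambda>z. z - c i) ` occupied n c, (\<lambda>z. z - c i) ` shared_points n c)"
  by (simp add: snapshot_def occupied_def shared_points_def image_image)

lemma shared_iff:
  assumes "i < n"
  shows "shared n c i \<longleftrightarrow> c i \<in> shared_points n c"
proof
  assume "shared n c i"
  then show "c i \<in> shared_points n c"
    using assms by (auto simp: shared_points_def)
next
  assume "c i \<in> shared_points n c"
  then obtain k where k: "k < n" "shared n c k" "c k = c i"
    unfolding shared_points_def by auto
  then show "shared n c i"
    by (cases "k = i") (auto simp: shared_def)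
qed

lemma scattered_card_occupied:
  assumes "scattered n c"
  shows "card (occupied n c) = n"
  using assms by (simp add: scattered_def occupied_def card_image)

text \<open>Stopping exactly at the destination is admissible for every \<open>\<delta>\<close>, so
  this single adversary serves rigid and non-rigid moves alike.\<close>

definition rigid_adversary :: adversary where
  "rigid_adversary = \<lparr>frames = \<lambda>_ _. id, stop = \<lambda>_ d. d\<rparr>"

lemma rigid_adversary_sel [simp]:
  "frames rigid_adversary h i = id" "stop rigid_adversary h d = d"
  by (simp_all add: rigid_adversary_def)

lemma is_adversary_rigid: "is_adversary \<delta> n rigid_adversary"
proof -
  have "is_frame id"
    unfolding is_frame_def by (auto intro!: exI[of _ 1] linear_id simp del: id_apply) simp
  then show ?thesis
    by (simp add: is_adversary_def moves_toward_def)
qed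

section \<open>Random bits bound the number of possibilities\<close>

text \<open>One robot is put on each point of \<open>P\<close>, a second one on each point of
  \<open>M\<close>, and all remaining ones on \<open>x\<close>. This crowds a point of multiplicity
  without changing what any snapshot shows.\<close>

lemma crowded_config:
  assumes M: "M \<subseteq> P" "finite P" and x: "x \<in> M" and n: "2 * card P \<le> n"
  obtains c where "occupied n c = P" "shared_points n c = M" "\<And>j. 2 * card P \<le> j \<Longrightarrow> c j = x"
proof -
  have finM: "finite M"
    using M finite_subset by blast
  obtain ps where ps: "set ps = P" "distinct ps"
    using finite_distinct_list M by blast
  obtain ms where ms: "set ms = M" "distinct ms"
    using finite_distinct_list finM by blast
  define m u where "m = length ps" and "u = length ms"
  have m: "m = card P" and u: "u = card M"
    using distinct_card[OF ps(2)] distinct_card[OF ms(2)] ps ms by (auto simp: m_def u_def)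
  have um: "u \<le> m"
    unfolding m u using M card_mono by blast
  define c where "c = (\<lambda>j. if j < m then ps ! j else if j < m + u then ms ! (j - m) else x)"
  have c_low: "c j \<in> P" if "j < m" for j
    using that ps by (auto simp: c_def m_def)
  have c_high: "c j \<in> M" if "m \<le> j" for j
    using that ms x by (auto simp: c_def u_def intro: nth_mem)
  have low: "\<exists>j<m. c j = z" if "z \<in> P" for z
    using that ps by (force simp: c_def m_def in_set_conv_nth)
  have high: "\<exists>j. m \<le> j \<and> j < m + u \<and> c j = z" if "z \<in> M" for z
  proof -
    obtain k where "k < u" "ms ! k = z"
      using \<open>z \<in> M\<close> unfolding ms(1)[symmetric] in_set_conv_nth u_def by blast
    then show ?thesis
      by (intro exI[of _ "m + k"]) (auto simp: c_def)
  qed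
  have mn: "m + u \<le> n"
    using n um m by simp
  have "occupied n c = P"
  proof
    show "occupied n c \<subseteq> P"
      using c_low c_high M unfolding occupied_def by (metis (no_types, lifting) image_subsetI not_le subsetD)
    show "P \<subseteq> occupied n c"
      using low mn unfolding occupied_def by fastforce
  qed
  moreover have "shared_points n c = M"
  proof
    show "shared_points n c \<subseteq> M"
    proof
      fix z assume "z \<in> shared_points n c"
      then obtain j where j: "z = c j" "shared n c j"
        by (auto simp: shared_points_def)
      then obtain k where jk: "z = c j" "k \<noteq> j" "c k = c j"
        by (auto simp: shared_def)
      \<comment> \<open>\<open>ps\<close> is distinct, so two of the first \<open>m\<close> robots
        never meet; one of \<open>j\<close>, \<open>k\<close> is at least \<open>m\<close> and
        therefore stands in \<open>M\<close>.\<close>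
      have "\<not> (j < m \<and> k < m)"
        using jk ps by (auto simp: c_def m_def nth_eq_iff_index_eq)
      then show "z \<in> M"
        using jk c_high by (metis not_le)
    qed
    show "M \<subseteq> shared_points n c"
    proof
      fix z assume z: "z \<in> M"
      obtain j where j: "j < m" "c j = z"
        using low z M by blast
      obtain k where k: "m \<le> k" "k < m + u" "c k = z"
        using high z by blast
      have "shared n c j"
        unfolding shared_def using j k mn by (intro exI[of _ k]) auto
      then show "z \<in> shared_points n c"
        using j k mn unfolding shared_points_def by force
    qed
  qed
  moreover have "c j = x" if "2 * card P \<le> j" for j
    using that um m by (auto simp: c_def)
  ultimately show thesis
    by (rule that)
qed

lemma size_ge_1: "well_defined A \<Longrightarrow> 1 \<le> size (A S)"
  by (simp add: well_defined_def Suc_le_eq nonempty_has_size del: split_paired_All)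

text \<open>Each unscattered entry of a history, the last one included, is charged for the round
  that starts there. Hence the history \<open>[c]\<close> of zero rounds already accounts for the
  first round.\<close>

lemma round_bits_le_expected_bits:
  assumes "is_adversary \<delta> n adv" "\<not> scattered n c"
  shows "ennreal (round_bits A n c (frames adv [c])) \<le> expected_bits \<delta> A n"
proof -
  have "ennreal (round_bits A n c (frames adv [c]))
      = (\<integral>\<^sup>+ h. ennreal (bits_used A n adv h) \<partial>measure_pmf (exec A n adv c 0))"
    using assms(2) by (simp add: bits_used_def rounds_used_def)
  also have "\<dots> \<le> expected_bits_from A n adv c"
    unfolding expected_bits_from_def by (rule SUP_upper) simp
  also have "\<dots> \<le> (SUP c. expected_bits_from A n adv c)"
    by (rule SUP_upper) simp
  also have "\<dots> \<le> expected_bits \<delta> A n"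
    unfolding expected_bits_def by (rule SUP_upper) (use assms in simp)
  finally show ?thesis .
qed

text \<open>Robot \<open>i\<close> cannot tell its configuration of \<open>k\<close> robots from a
  crowded one of \<open>n\<close> robots. There at least \<open>n - 2 * m \<ge> n / 2\<close> robots
  share its snapshot, and each of them pays for the same number of possibilities in the first
  round.\<close>

lemma choices_le_expected_bits:
  assumes wd: "well_defined A" and fin: "expected_bits \<delta> A n < \<infinity>"
    and i: "i < k" "shared k c i" and n: "4 * card (occupied k c) \<le> n"
  shows "real n / 2 * log 2 (size (A (snapshot k c id i))) \<le> enn2real (expected_bits \<delta> A n)"
proof -
  define m where "m = card (occupied k c)"
  have x: "c i \<in> shared_points k c"
    using i shared_iff by blast
  then have m: "m > 0"
    using shared_points_subset[of k c] by (auto simp: m_def card_gt_0_iff)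
  obtain c' where c': "occupied n c' = occupied k c" "shared_points n c' = shared_points k c"
      "\<And>j. 2 * m \<le> j \<Longrightarrow> c' j = c i"
    using crowded_config[OF shared_points_subset finite_occupied x, of n] n unfolding m_def by auto
  have sh: "shared n c' j" if "2 * m \<le> j" "j < n" for j
    using that x c' by (simp add: shared_iff)
  have "2 * m < n"
    using n m unfolding m_def by linarith
  then have nsc: "\<not> scattered n c'"
    using sh[of "2 * m"] unfolding scattered_def shared_def inj_on_def by auto
  let ?L = "log 2 (size (A (snapshot k c id i)))"
  have pos: "0 \<le> log 2 (size (A S))" for S
    using size_ge_1[OF wd, of S] by simp
  have snap: "snapshot n c' id j = snapshot k c id i" if "2 * m \<le> j" for j
    using c' that by (simp add: snapshot_id)
  have "real n / 2 \<le> real (n - 2 * m)"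
    using n unfolding m_def by linarith
  then have "real n / 2 * ?L \<le> real (n - 2 * m) * ?L"
    using pos by (intro mult_right_mono)
  also have "\<dots> = (\<Sum>j\<in>{2*m..<n}. log 2 (size (A (snapshot n c' id j))))"
    by (simp add: snap)
  also have "\<dots> \<le> round_bits A n c' (frames rigid_adversary [c'])"
    unfolding round_bits_def rigid_adversary_sel by (intro sum_mono2 pos) (auto simp: sh)
  also have "\<dots> \<le> enn2real (expected_bits \<delta> A n)"
  proof -
    have "0 \<le> round_bits A n c' (frames rigid_adversary [c'])"
      unfolding round_bits_def by (intro sum_nonneg pos)
    \<comment> \<open>Finiteness is essential: \<open>enn2real\<close> would send an infinite
      expectation to 0.\<close>
    then show ?thesis
      using enn2real_mono[OF round_bits_le_expected_bits[OF is_adversary_rigid nsc, of A], of \<delta>] fin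
      by (simp only: enn2real_ennreal infinity_ennreal_def)
  qed
  finally show ?thesis .
qed

text \<open>A crowd of size linear in the number of occupied points suffices. Dividing the
  \<open>O(n log n)\<close> bound by the size of the crowd leaves a logarithmic bound on the bits
  per robot, with constants independent of the actual number of robots.\<close>

lemma choices_polynomial:
  assumes wd: "well_defined A" and opt: "random_bit_optimal \<delta> A"
  obtains N e :: nat where "2 \<le> N"
    "\<And>n c i. i < n \<Longrightarrow> shared n c i \<Longrightarrow>
       size (A (snapshot n c id i)) \<le> (N * card (occupied n c)) ^ e"
proof -
  obtain C where C: "C > 0" "\<forall>\<^sub>F n in sequentially.
      norm (enn2real (expected_bits \<delta> A n)) \<le> C * norm (real n * ln (real n))"
    using opt unfolding random_bit_optimal_def by (blast elim: landau_o.bigE)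
  have "\<forall>\<^sub>F n in sequentially. expected_bits \<delta> A n < \<infinity> \<and>
      norm (enn2real (expected_bits \<delta> A n)) \<le> C * norm (real n * ln (real n))"
    using opt C unfolding random_bit_optimal_def by (auto intro: eventually_conj)
  then obtain N0 where N0: "\<And>n. N0 \<le> n \<Longrightarrow> expected_bits \<delta> A n < \<infinity> \<and>
      enn2real (expected_bits \<delta> A n) \<le> C * norm (real n * ln (real n))"
    unfolding eventually_sequentially by auto
  \<comment> \<open>The factor 2 compensates for only half of the robots being counted.\<close>
  define e where "e = nat \<lceil>2 * C\<rceil>"
  show thesis
  proof (rule that[of "4 + N0" e])
    fix n c i assume i: "i < n" "shared n c i"
    let ?p = "size (A (snapshot n c id i))" and ?m = "card (occupied n c)"
    have m: "?m \<ge> 1"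
      using i by (auto simp: Suc_le_eq card_gt_0_iff occupied_def)
    \<comment> \<open>The factor makes \<open>n'\<close> large enough both for the crowd
      (\<open>4 * ?m\<close>) and for the asymptotic bound (\<open>N0\<close>), while keeping it
      linear in \<open>?m\<close>.\<close>
    define n' where "n' = (4 + N0) * ?m"
    have n': "4 * ?m \<le> n'" "N0 \<le> n'" "4 \<le> n'"
      using m by (auto simp: n'_def algebra_simps intro: trans_le_add1)
    then have pos: "0 \<le> ln (real n')" "0 < real n'"
      by auto
    have p: "1 \<le> ?p"
      using size_ge_1[OF wd] .
    have "real n' / 2 * log 2 ?p \<le> C * (real n' * ln (real n'))"
      using choices_le_expected_bits[OF wd _ i n'(1)] N0[OF n'(2)] pos
      by (smt (verit) mult_nonneg_nonneg real_norm_def)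
    then have "real n' * log 2 ?p \<le> real n' * (2 * C * ln (real n'))"
      by (simp add: algebra_simps)
    then have "log 2 ?p \<le> 2 * C * ln (real n')"
      using pos by simp
    also have "\<dots> \<le> real e * ln (real n')"
      using pos unfolding e_def by (intro mult_right_mono) linarith+
    finally have *: "log 2 ?p \<le> real e * ln (real n')" .
    have "ln ?p \<le> log 2 ?p"
    proof -
      have "ln (2::real) \<le> 1" "ln (2::real) > 0" using ln_2_less_1 by auto
      moreover have "ln (real ?p) \<ge> 0" using p by simp
      ultimately show ?thesis
        using mult_right_mono[of "ln 2" 1 "ln (real ?p)"] by (simp add: log_def field_simps)
    qed
    with * have "ln ?p \<le> ln (real n' ^ e)"
      using pos by (simp add: ln_realpow)
    then have "real ?p \<le> real n' ^ e"
      using p pos by (subst (asm) ln_le_cancel_iff) auto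
    then have "?p \<le> n' ^ e"
      by (metis of_nat_le_iff of_nat_power)
    then show "?p \<le> ((4 + N0) * ?m) ^ e"
      by (simp add: n'_def)
  qed simp
qed

section \<open>Growth of the number of occupied points\<close>

text \<open>All robots on a shared point draw from the same multiset, so they spread over at most
  \<open>B\<close> points. A lone robot reaches only one point, however many uncounted bits it uses.
  The bound holds for every outcome in the support, not just on average.\<close>

lemma card_occupied_round:
  assumes wd: "well_defined A" and B: "1 \<le> B"
    and choices: "\<And>i. i < n \<Longrightarrow> shared n c i \<Longrightarrow> size (A (snapshot n c id i)) \<le> B"
    and d: "\<And>i. i < n \<Longrightarrow> d i \<in> set_pmf (destination A n c id i)"
  shows "card (occupied n d) \<le> card (occupied n c) * B"
proof -
  define G where "G = (\<lambda>y. {i. i < n \<and> c i = y})"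
  have "card (d ` G y) \<le> B" if "y \<in> occupied n c" for y
  proof -
    from that obtain i where i: "i < n" "c i = y"
      by (auto simp: occupied_def)
    show ?thesis
    proof (cases "shared n c i")
      case True
      let ?D = "(\<lambda>x. y + x) ` set_mset (A (snapshot n c id i))"
      have "d ` G y \<subseteq> ?D"
      proof
        fix z assume "z \<in> d ` G y"
        then obtain j where j: "j < n" "c j = y" "z = d j"
          by (auto simp: G_def)
        have "snapshot n c id j = snapshot n c id i"
          using i j by (simp add: snapshot_id)
        moreover have "A (snapshot n c id i) \<noteq> {#}"
          using wd unfolding well_defined_def by blast
        ultimately show "z \<in> ?D"
          using d[OF j(1)] j by (simp add: destination_def)
      qed
      then have "card (d ` G y) \<le> card ?D"
        by (intro card_mono) auto
      also have "\<dots> \<le> card (set_mset (A (snapshot n c id i)))"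
        by (intro card_image_le) simp
      also have "\<dots> \<le> size (A (snapshot n c id i))"
        unfolding size_multiset_overloaded_eq card_eq_sum
        by (intro sum_mono) (simp add: Suc_le_eq)
      also have "\<dots> \<le> B"
        using choices i True by simp
      finally show ?thesis .
    next
      case False
      then have "G y = {i}"
        using i by (auto simp: G_def shared_def)
      then show ?thesis
        using B by simp
    qed
  qed
  then have "(\<Sum>y\<in>occupied n c. card (d ` G y)) \<le> card (occupied n c) * B"
    using sum_bounded_above[of "occupied n c" "\<lambda>y. card (d ` G y)" B] by simp
  moreover have "occupied n d = (\<Union>y\<in>occupied n c. d ` G y)"
    by (auto simp: occupied_def G_def)
  ultimately show ?thesis
    using card_UN_le[OF finite_occupied[of n c], of "\<lambda>y. d ` G y"] by simp
qed

text \<open>For \<open>a = N * m\<close>, with \<open>m\<close> occupied points, one round turns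
  \<open>a\<close> into at most \<open>a * a ^ e\<close>. The factor \<open>N\<close> absorbs the
  constant of the polynomial bound, so the recursion is a pure power and iterates to a double
  exponential from \<open>a = N\<close>, all robots starting on one point.\<close>

lemma exec_card_occupied:
  assumes wd: "well_defined A" and N: "2 \<le> N" and n: "0 < n"
    and choices: "\<And>c i. i < n \<Longrightarrow> shared n c i \<Longrightarrow>
       size (A (snapshot n c id i)) \<le> (N * card (occupied n c)) ^ e"
    and h: "h \<in> set_pmf (exec A n rigid_adversary (\<lambda>_. 0) t)"
  shows "length h = Suc t \<and> (\<forall>k\<le>t. N * card (occupied n (h ! k)) \<le> N ^ (e + 2) ^ k)"
  using h
proof (induction t arbitrary: h)
  case 0
  have "occupied n (\<lambda>_. 0) = {0}"
    using n by (auto simp: occupied_def)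
  with 0 show ?case by simp
next
  case (Suc t)
  then obtain g d where g: "g \<in> set_pmf (exec A n rigid_adversary (\<lambda>_. 0) t)" "h = g @ [d]"
      and d: "d \<in> set_pmf (round_pmf A n rigid_adversary g)"
    by auto
  note IH = Suc.IH[OF g(1)]
  define c where "c = last g"
  have c: "c = g ! t"
    using IH by (metis c_def diff_Suc_1 last_conv_nth length_0_conv nat.distinct(1))
  define m where "m = card (occupied n c)"
  have m: "m \<ge> 1"
    using n by (auto simp: m_def Suc_le_eq card_gt_0_iff occupied_def)
  then have Nm: "1 \<le> N * m" "N \<le> N * m"
    using N by (auto simp: Suc_le_eq)
  have "d i \<in> set_pmf (destination A n c id i)" if "i < n" for i
    using d that by (auto simp: round_pmf_def c_def set_Pi_pmf PiE_dflt_def)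
  then have "card (occupied n d) \<le> m * (N * m) ^ e"
    using card_occupied_round[OF wd _ choices, of "c" d] Nm unfolding m_def by auto
  then have "N * card (occupied n d) \<le> (N * m) * (N * m) ^ e"
    by (metis mult.assoc mult_le_mono2)
  also have "\<dots> = (N * m) ^ (e + 1)"
    by simp
  \<comment> \<open>The exponent \<open>e + 1\<close> is relaxed to \<open>e + 2\<close> so that the
    base of the iterated exponent is at least 2 even for \<open>e = 0\<close>.\<close>
  also have "\<dots> \<le> (N * m) ^ (e + 2)"
    using Nm by (intro power_increasing) auto
  also have "\<dots> \<le> (N ^ (e + 2) ^ t) ^ (e + 2)"
    using IH c by (intro power_mono) (auto simp: m_def)
  also have "\<dots> = N ^ (e + 2) ^ Suc t"
    by (simp only: power_mult[symmetric] power_Suc mult.commute)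
  finally show ?case
    using IH g by (auto simp: nth_append le_Suc_eq)
qed

section \<open>Lower bound on the rounds and the contradiction\<close>

text \<open>If no history in the support contains a scattered configuration,
  \<open>rounds_used\<close> is the full length \<open>Suc T\<close> with certainty. The last
  configuration counts as well, since it still requires another round.\<close>

lemma expected_rounds_lower_bound:
  assumes adv: "is_adversary \<delta> n adv"
    and h: "\<And>h. h \<in> set_pmf (exec A n adv c T) \<Longrightarrow> length h = Suc T \<and> (\<forall>c'\<in>set h. \<not> scattered n c')"
  shows "of_nat (Suc T) \<le> expected_rounds \<delta> A n"
proof -
  have "of_nat (Suc T) = (\<integral>\<^sup>+ h. of_nat (Suc T) \<partial>measure_pmf (exec A n adv c T))"
    by (simp add: measure_pmf.emeasure_space_1)
  also have "\<dots> = (\<integral>\<^sup>+ h. of_nat (rounds_used n h) \<partial>measure_pmf (exec A n adv c T))"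
    by (intro nn_integral_cong_AE AE_pmfI) (use h in \<open>simp add: rounds_used_def takeWhile_eq_all_conv[THEN iffD2]\<close>)
  also have "\<dots> \<le> expected_rounds_from A n adv c"
    unfolding expected_rounds_from_def by (rule SUP_upper) simp
  also have "\<dots> \<le> (SUP c. expected_rounds_from A n adv c)"
    by (rule SUP_upper) simp
  also have "\<dots> \<le> expected_rounds \<delta> A n"
    unfolding expected_rounds_def by (rule SUP_upper) (use adv in simp)
  finally show ?thesis .
qed

theorem theorem8:
  fixes \<delta> :: ereal
  assumes "\<delta> > 0"
  shows "\<not> (\<exists>A. scattering_algorithm \<delta> A \<and> random_bit_optimal \<delta> A \<and> rounds_o_loglog \<delta> A)"
proof
  assume "\<exists>A. scattering_algorithm \<delta> A \<and> random_bit_optimal \<delta> A \<and> rounds_o_loglog \<delta> A"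
  then obtain A where wd: "well_defined A" and opt: "random_bit_optimal \<delta> A"
      and fast: "rounds_o_loglog \<delta> A"
    by (auto simp: scattering_algorithm_def)
  obtain N e where N: "2 \<le> N" and choices:
      "\<And>n c i. i < n \<Longrightarrow> shared n c i \<Longrightarrow>
         size (A (snapshot n c id i)) \<le> (N * card (occupied n c)) ^ e"
    using choices_polynomial[OF wd opt] by metis
  \<comment> \<open>Chosen so that the final estimate gives \<open>ln (ln n) < b * Suc T\<close>.
    The absolute value covers \<open>N = 2\<close>, where \<open>ln (ln N)\<close> is negative; the
    summand 1 makes \<open>b\<close> positive and the estimate strict.\<close>
  define b where "b = ln (real (e + 2)) + \<bar>ln (ln (real N))\<bar> + 1"
  have b: "b > 0"
    by (simp add: b_def add_nonneg_pos)
  have "\<forall>\<^sub>F n in sequentially. norm (enn2real (expected_rounds \<delta> A n))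
      \<le> 1 / b * norm (ln (ln (real n)))"
    using fast b unfolding rounds_o_loglog_def by (intro landau_o.smallD) auto
  moreover have "\<forall>\<^sub>F n in sequentially. expected_rounds \<delta> A n < \<infinity>"
    using fast by (simp add: rounds_o_loglog_def)
  ultimately have "\<forall>\<^sub>F n in sequentially. expected_rounds \<delta> A n < \<infinity> \<and>
      norm (enn2real (expected_rounds \<delta> A n)) \<le> 1 / b * norm (ln (ln (real n)))"
    by eventually_elim simp
  then obtain n0 where n0: "\<And>n. n0 \<le> n \<Longrightarrow> expected_rounds \<delta> A n < \<infinity> \<and>
      enn2real (expected_rounds \<delta> A n) \<le> 1 / b * \<bar>ln (ln (real n))\<bar>"
    unfolding eventually_sequentially by auto
  \<comment> \<open>\<open>T\<close> exceeds \<open>n0\<close> so that \<open>n\<close> lies in the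
    asymptotic range, and \<open>T \<ge> 1\<close> gives \<open>n \<ge> 3\<close>. The number
    \<open>n\<close> is just above the bound on the occupied points for the first \<open>T\<close>
    rounds, so none of them can scatter the robots.\<close>
  define T where "T = n0 + 1"
  define n where "n = N ^ (e + 2) ^ T + 1"
  have "T < (e + 2) ^ T"
    by (rule power_gt_expt) simp
  also have "\<dots> < N ^ (e + 2) ^ T"
    using N by (intro power_gt_expt) simp
  finally have T: "T < N ^ (e + 2) ^ T" .
  then have n: "n0 \<le> n" "3 \<le> n"
    by (auto simp: n_def T_def)

  have "of_nat (Suc T) \<le> expected_rounds \<delta> A n"
  proof (rule expected_rounds_lower_bound[OF is_adversary_rigid, where c = "\<lambda>_. 0"])
    fix h assume "h \<in> set_pmf (exec A n rigid_adversary (\<lambda>_. 0) T)"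
    then have "length h = Suc T \<and> (\<forall>k\<le>T. N * card (occupied n (h ! k)) \<le> N ^ (e + 2) ^ k)"
      using n by (intro exec_card_occupied[OF wd N _ choices]) auto
    then have h: "length h = Suc T" "\<And>k. k \<le> T \<Longrightarrow> N * card (occupied n (h ! k)) \<le> N ^ (e + 2) ^ k"
      by blast+
    have "\<not> scattered n (h ! k)" if "k \<le> T" for k
    proof
      assume "scattered n (h ! k)"
      then have "N * n \<le> N ^ (e + 2) ^ k"
        using h(2)[OF that] by (simp add: scattered_card_occupied)
      also have "\<dots> \<le> N ^ (e + 2) ^ T"
        using that N by (intro power_increasing) auto
      also have "\<dots> < n"
        by (simp add: n_def)
      finally show False
        using N by simp
    qed
    then show "length h = Suc T \<and> (\<forall>c'\<in>set h. \<not> scattered n c')"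
      using h by (auto simp: in_set_conv_nth less_Suc_eq_le)
  qed
  then have "real (Suc T) \<le> enn2real (expected_rounds \<delta> A n)"
    using enn2real_mono[of "of_nat (Suc T)" "expected_rounds \<delta> A n"] n0[OF n(1)]
    by (simp add: ennreal_of_nat_eq_real_of_nat del: of_nat_Suc)
  also have "\<dots> \<le> 1 / b * \<bar>ln (ln (real n))\<bar>"
    using n0[OF n(1)] by simp
  finally have upper: "b * real (Suc T) \<le> \<bar>ln (ln (real n))\<bar>"
    using b by (simp add: field_simps)

  \<comment> \<open>From \<open>3 \<le> n\<close> follows \<open>ln (ln n) \<ge> 0\<close>, which
    removes the absolute value in \<open>upper\<close>.\<close>
  have "exp 1 \<le> real n"
    using exp_le n by linarith
  then have ln_n: "1 \<le> ln (real n)"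
    using n by (simp add: ln_ge_iff)
  \<comment> \<open>Conversely, \<open>n\<close> must not be too large for \<open>T\<close>: the
    extra 1 in \<open>n\<close> is absorbed by one more factor \<open>N\<close>, and that factor by
    passing from \<open>T\<close> to \<open>Suc T\<close> in the exponent.\<close>
  have "n \<le> N ^ (e + 2) ^ T * N"
  proof -
    have "n \<le> N ^ (e + 2) ^ T * 2"
      using T by (simp add: n_def)
    then show ?thesis
      using N by (meson le_trans mult_le_mono2)
  qed
  also have "\<dots> = N ^ ((e + 2) ^ T + 1)"
    by simp
  also have "\<dots> \<le> N ^ (e + 2) ^ Suc T"
  proof (rule power_increasing)
    have "(1::nat) \<le> (e + 2) ^ T" by simp
    then have "(e + 2) ^ T + 1 \<le> 2 * (e + 2) ^ T" by linarith
    also have "\<dots> \<le> (e + 2) ^ Suc T" by simp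
    finally show "(e + 2) ^ T + 1 \<le> (e + 2) ^ Suc T" .
  qed (use N in simp)
  finally have "real n \<le> real N ^ (e + 2) ^ Suc T"
    by (metis of_nat_le_iff of_nat_power)
  then have "ln (real n) \<le> ln (real N ^ (e + 2) ^ Suc T)"
    using n by (intro ln_mono) auto
  also have "\<dots> = real (e + 2) ^ Suc T * ln (real N)"
    using N by (simp add: ln_realpow del: power_Suc)
  finally have "ln (ln (real n)) \<le> ln (real (e + 2) ^ Suc T * ln (real N))"
    using ln_n by (intro ln_mono) auto
  also have "\<dots> = real (Suc T) * ln (real (e + 2)) + ln (ln (real N))"
    using N by (subst ln_mult) (auto simp: ln_realpow simp del: power_Suc)
  also have "\<dots> \<le> real (Suc T) * ln (real (e + 2)) + real (Suc T) * \<bar>ln (ln (real N))\<bar>"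
    using mult_right_mono[of 1 "real (Suc T)" "\<bar>ln (ln (real N))\<bar>"] by simp
  also have "\<dots> < b * real (Suc T)"
    by (simp add: b_def algebra_simps)
  finally show False
    using upper ln_n by (simp add: ln_ge_zero)
qed

end
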